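(* Let $\Gamma$ be a finitely generated group acting continuously on a compact metric space $Y$, and assume the action $\Gamma\curvearrowright Y$ is free. If the warped cone $\mathcal{O}_\Gamma Y$ admits a coarse embedding into a Hilbert space, then the action $\Gamma\curvearrowright Y$ is a-T-menable.
   Context: Warped cone. Let $\Gamma$ be a group with a fixed finite generating set $S$, acting continuously on a compact metric space $(Y,d)$ with $\operatorname{diam}(Y)>0$. The infinite cone $\mathcal{O}Y$ is $(0,\infty)\times Y$ with the metric $d((r,y),(r',y')) = |r-r'|\cdot\operatorname{diam}(Y)+\min(r,r')\cdot d(y,y')$ and the action $\gamma(r,y)=(r,\gamma y)$. The warped cone $\mathcal{O}_\Gamma Y$ is $\mathcal{O}Y$ equipped with the warped metric $d_\Gamma$: the largest metric on $\mathcal{O}Y$ such that $d_\Gamma\le d$ and $d_\Gamma(x,sx)\le 1$ for all $x\in\mathcal{O}Y$, $s\in S$. Coarse embedding. A map $f\colon X\to Z$ between metric spaces is a coarse embedding if there are non-decreasing unbounded functions $\rho_-,\rho_+\colon[0,\infty)\to[0,\infty)$ with $\rho_-(d_X(x,x'))\le d_Z(f(x),f(x'))\le\rho_+(d_X(x,x'))$ for all $x,x'\in X$. A-T-menable action. An action $\Gamma\curvearrowright Y$ is a-T-menable if there exists a continuous function $h\colon\Gamma\times Y\to[0,\infty)$ ($\Gamma$ discrete) which is symmetric: $h(\gamma,y)=h(\gamma^{-1},\gamma y)$; normalised: $h(e,y)=0$; proper; and (conditionally) negative-definite: for any $y\in Y$ and any finitely supported $(\lambda_\gamma)\in\mathbb{R}^\Gamma$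 with $\sum_\gamma\lambda_\gamma=0$, one has $\sum_{\gamma,\gamma'\in\Gamma}\lambda_\gamma\lambda_{\gamma'}h(\gamma'\gamma^{-1},\gamma y)\le 0$. Free means that $\gamma y=y$ for some $y\in Y$ implies $\gamma=e$. *)

theory Defs
  imports "HOL-Analysis.Analysis" "HOL-Algebra.Generated_Groups" "HOL-Algebra.Group_Action"
begin

section \<open>Actions\<close>

text \<open>
  Algebraic actions are those of \<^locale>\<open>group_action\<close>: the map \<open>\<phi>\<close> is a homomorphism from \<open>G\<close> to the
  group of bijections of \<open>Y\<close>. Since \<open>G\<close> is discrete, the action is continuous iff each \<open>\<phi> g\<close> is.
\<close>

definition continuous_action ::
  "('g, 'm) monoid_scheme \<Rightarrow> 'a::topological_space set \<Rightarrow> ('g \<Rightarrow> 'a \<Rightarrow> 'a) \<Rightarrow> bool"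
  where "continuous_action G Y \<phi> \<longleftrightarrow>
    group_action G Y \<phi> \<and> (\<forall>g\<in>carrier G. continuous_on Y (\<phi> g))"

definition free_action ::
  "('g, 'm) monoid_scheme \<Rightarrow> 'a set \<Rightarrow> ('g \<Rightarrow> 'a \<Rightarrow> 'a) \<Rightarrow> bool"
  where "free_action G Y \<phi> \<longleftrightarrow>
    (\<forall>g\<in>carrier G. \<forall>y\<in>Y. \<phi> g y = y \<longrightarrow> g = \<one>\<^bsub>G\<^esub>)"


section \<open>Warped cones\<close>

definition infinite_cone :: "'a set \<Rightarrow> (real \<times> 'a) set"
  where "infinite_cone Y = {0<..} \<times> Y"

definition cone_dist :: "'a::metric_space set \<Rightarrow> real \<times> 'a \<Rightarrow> real \<times> 'a \<Rightarrow> real"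
  where "cone_dist Y p q =
    \<bar>fst p - fst q\<bar> * diameter Y + min (fst p) (fst q) * dist (snd p) (snd q)"

definition cone_action :: "('g \<Rightarrow> 'a \<Rightarrow> 'a) \<Rightarrow> 'g \<Rightarrow> real \<times> 'a \<Rightarrow> real \<times> 'a"
  where "cone_action \<phi> g p = (fst p, \<phi> g (snd p))"

definition warping_metrics ::
  "'g set \<Rightarrow> ('g \<Rightarrow> 'a \<Rightarrow> 'a) \<Rightarrow> 'a::metric_space set \<Rightarrow> (real \<times> 'a \<Rightarrow> real \<times> 'a \<Rightarrow> real) set"
  where "warping_metrics S \<phi> Y = {\<delta>. Metric_space (infinite_cone Y) \<delta> \<and>
    (\<forall>p\<in>infinite_cone Y. \<forall>q\<in>infinite_cone Y. \<delta> p q \<le> cone_dist Y p q) \<and>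
    (\<forall>p\<in>infinite_cone Y. \<forall>s\<in>S. \<delta> p (cone_action \<phi> s p) \<le> 1)}"

text \<open>
  The warped metric is the largest element of \<^const>\<open>warping_metrics\<close>, obtained as the pointwise
  supremum; that it is itself a member, hence the maximum, is shown below. The value \<open>0\<close> off
  the cone only serves to meet the global axioms of \<^locale>\<open>Metric_space\<close>.
\<close>

definition warped_dist ::
  "'g set \<Rightarrow> ('g \<Rightarrow> 'a \<Rightarrow> 'a) \<Rightarrow> 'a::metric_space set \<Rightarrow> real \<times> 'a \<Rightarrow> real \<times> 'a \<Rightarrow> real"
  where "warped_dist S \<phi> Y p q =
    (if p \<in> infinite_cone Y \<and> q \<in> infinite_cone Y then SUP \<delta>\<in>warping_metrics S \<phi> Y. \<delta> p q else 0)"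

lemma cone_dist_triangle:
  assumes "bounded Y" "p \<in> infinite_cone Y" "q \<in> infinite_cone Y" "z \<in> infinite_cone Y"
  shows "cone_dist Y p z \<le> cone_dist Y p q + cone_dist Y q z"
proof -
  obtain a x where p: "p = (a, x)" by (cases p)
  obtain b y where q: "q = (b, y)" by (cases q)
  obtain c w where z: "z = (c, w)" by (cases z)
  have pos: "0 < a" "0 < b" "0 < c" and Y: "x \<in> Y" "y \<in> Y" "w \<in> Y"
    using assms by (auto simp: p q z infinite_cone_def)
  define D where "D = diameter Y"
  have D: "dist x w \<le> D" "0 \<le> D"
    unfolding D_def using assms(1) Y diameter_bounded_bound diameter_ge_0 by blast+
  have tri: "dist x w \<le> dist x y + dist y w" by (rule dist_triangle)
  have "\<bar>a - c\<bar> * D + min a c * dist x w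
      \<le> (\<bar>a - b\<bar> * D + min a b * dist x y) + (\<bar>b - c\<bar> * D + min b c * dist y w)"
  proof (cases "min a c \<le> b")
    case True
    have "min a c * dist x w \<le> min a c * (dist x y + dist y w)"
      using pos tri by (intro mult_left_mono) auto
    also have "\<dots> \<le> min a b * dist x y + min b c * dist y w"
      unfolding distrib_left using True by (intro add_mono mult_right_mono) auto
    finally have 1: "min a c * dist x w \<le> min a b * dist x y + min b c * dist y w" .
    have "\<bar>a - c\<bar> * D \<le> (\<bar>a - b\<bar> + \<bar>b - c\<bar>) * D"
      using D by (intro mult_right_mono) auto
    with 1 show ?thesis by (simp add: algebra_simps)
  next
    case False
    define m where "m = min a c"
    have m: "b < m" "b < a" "b < c" using False by (auto simp: m_def)
    have eq: "\<bar>a - b\<bar> + \<bar>b - c\<bar> = \<bar>a - c\<bar> + 2 * (m - b)" "min a b = b" "min b c = b"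
      using m(2,3) by (auto simp: m_def min_def)
    have "m * dist x w = b * dist x w + (m - b) * dist x w"
      by (simp add: algebra_simps)
    also have "\<dots> \<le> b * (dist x y + dist y w) + (m - b) * D"
      using pos m tri D by (intro add_mono mult_left_mono) auto
    also have "\<dots> \<le> b * (dist x y + dist y w) + 2 * (m - b) * D"
      using m D by (intro add_left_mono mult_right_mono) auto
    finally have "\<bar>a - c\<bar> * D + m * dist x w
        \<le> b * (dist x y + dist y w) + (\<bar>a - c\<bar> + 2 * (m - b)) * D"
      by (simp add: algebra_simps)
    then show ?thesis
      unfolding eq(1)[symmetric] eq(2,3) m_def[symmetric] by (simp add: algebra_simps)
  qed
  then show ?thesis by (simp add: cone_dist_def p q z D_def)
qed

lemma Metric_space_cone:
  assumes "bounded Y" "0 < diameter Y"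
  shows "Metric_space (infinite_cone Y)
    (\<lambda>p q. if p \<in> infinite_cone Y \<and> q \<in> infinite_cone Y then cone_dist Y p q else 0)"
proof
  fix p q z
  show "0 \<le> (if p \<in> infinite_cone Y \<and> q \<in> infinite_cone Y then cone_dist Y p q else 0)"
    using assms by (auto simp: cone_dist_def infinite_cone_def)
  show "(if p \<in> infinite_cone Y \<and> q \<in> infinite_cone Y then cone_dist Y p q else 0) =
        (if q \<in> infinite_cone Y \<and> p \<in> infinite_cone Y then cone_dist Y q p else 0)"
    by (auto simp: cone_dist_def dist_commute min.commute abs_minus_commute)
  assume pq: "p \<in> infinite_cone Y" "q \<in> infinite_cone Y"
  show "(if p \<in> infinite_cone Y \<and> q \<in> infinite_cone Y then cone_dist Y p q else 0) = 0 \<longleftrightarrow> p = q"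
  proof
    assume "(if p \<in> infinite_cone Y \<and> q \<in> infinite_cone Y then cone_dist Y p q else 0) = 0"
    then have 0: "\<bar>fst p - fst q\<bar> * diameter Y + min (fst p) (fst q) * dist (snd p) (snd q) = 0"
      using pq by (simp add: cone_dist_def)
    have pos: "0 < min (fst p) (fst q)" using pq by (auto simp: infinite_cone_def)
    then have "0 \<le> \<bar>fst p - fst q\<bar> * diameter Y" "0 \<le> min (fst p) (fst q) * dist (snd p) (snd q)"
      using assms(2) by (auto intro!: mult_nonneg_nonneg)
    with 0 have "\<bar>fst p - fst q\<bar> * diameter Y = 0" "min (fst p) (fst q) * dist (snd p) (snd q) = 0"
      by linarith+
    then show "p = q" using pos assms(2) by (auto simp: prod_eq_iff)
  qed (simp add: cone_dist_def)
  assume "z \<in> infinite_cone Y"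
  then show "(if p \<in> infinite_cone Y \<and> z \<in> infinite_cone Y then cone_dist Y p z else 0)
     \<le> (if p \<in> infinite_cone Y \<and> q \<in> infinite_cone Y then cone_dist Y p q else 0) +
       (if q \<in> infinite_cone Y \<and> z \<in> infinite_cone Y then cone_dist Y q z else 0)"
    using pq cone_dist_triangle[OF assms(1)] by simp
qed

lemma warping_metrics_nonempty:
  assumes "bounded Y" "0 < diameter Y"
  shows "warping_metrics S \<phi> Y \<noteq> {}"
proof -
  let ?d = "\<lambda>p q. if p \<in> infinite_cone Y \<and> q \<in> infinite_cone Y then cone_dist Y p q else 0"
  interpret Metric_space "infinite_cone Y" ?d using assms by (rule Metric_space_cone)
  have "capped_dist 1 \<in> warping_metrics S \<phi> Y"
    unfolding warping_metrics_def using capped_dist[of 1] by (auto simp: capped_dist_def)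
  then show ?thesis by blast
qed

lemma warping_metrics_le_warped_dist:
  assumes "\<delta> \<in> warping_metrics S \<phi> Y" "p \<in> infinite_cone Y" "q \<in> infinite_cone Y"
  shows "\<delta> p q \<le> warped_dist S \<phi> Y p q"
proof -
  have "bdd_above ((\<lambda>\<delta>. \<delta> p q) ` warping_metrics S \<phi> Y)"
    using assms(2,3) by (intro bdd_aboveI[of _ "cone_dist Y p q"]) (auto simp: warping_metrics_def)
  then show ?thesis using assms by (auto simp: warped_dist_def intro: cSUP_upper2)
qed

lemma warped_dist_le:
  assumes "bounded Y" "0 < diameter Y" "p \<in> infinite_cone Y" "q \<in> infinite_cone Y"
    and "\<And>\<delta>. \<delta> \<in> warping_metrics S \<phi> Y \<Longrightarrow> \<delta> p q \<le> C"
  shows "warped_dist S \<phi> Y p q \<le> C"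
  using assms warping_metrics_nonempty[OF assms(1,2), of S \<phi>]
  by (auto simp: warped_dist_def intro: cSUP_least)

theorem warped_dist_in_warping_metrics:
  assumes "bounded Y" "0 < diameter Y" "\<And>s. s \<in> S \<Longrightarrow> \<phi> s ` Y \<subseteq> Y"
  shows "warped_dist S \<phi> Y \<in> warping_metrics S \<phi> Y"
proof -
  let ?w = "warped_dist S \<phi> Y"
  note le = warped_dist_le[OF assms(1,2)] and ge = warping_metrics_le_warped_dist
  obtain \<delta>0 where \<delta>0: "\<delta>0 \<in> warping_metrics S \<phi> Y"
    using warping_metrics_nonempty[OF assms(1,2)] by blast
  have MS: "Metric_space (infinite_cone Y) \<delta>" if "\<delta> \<in> warping_metrics S \<phi> Y" for \<delta>
    using that by (simp add: warping_metrics_def)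
  have "Metric_space (infinite_cone Y) ?w"
  proof
    fix p q z
    show "0 \<le> ?w p q"
    proof (cases "p \<in> infinite_cone Y \<and> q \<in> infinite_cone Y")
      case True
      then show ?thesis using ge[OF \<delta>0] Metric_space.nonneg[OF MS[OF \<delta>0], of p q]
        by (meson order_trans)
    qed (auto simp: warped_dist_def)
    have "\<delta> p q = \<delta> q p" if "\<delta> \<in> warping_metrics S \<phi> Y" for \<delta>
      using Metric_space.commute[OF MS[OF that]] .
    then show "?w p q = ?w q p"
      by (auto simp: warped_dist_def intro!: SUP_cong)
    assume pq: "p \<in> infinite_cone Y" "q \<in> infinite_cone Y"
    show "?w p q = 0 \<longleftrightarrow> p = q"
    proof
      assume "?w p q = 0"
      then have "\<delta>0 p q = 0"
        using ge[OF \<delta>0 pq] Metric_space.nonneg[OF MS[OF \<delta>0], of p q] by linarith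
      then show "p = q" using Metric_space.zero[OF MS[OF \<delta>0] pq] by simp
    next
      assume "p = q"
      then have "?w p q \<le> 0"
        using pq le[OF pq, of S \<phi> 0] Metric_space.zero[OF MS pq] by fastforce
      then show "?w p q = 0" using \<open>0 \<le> ?w p q\<close> by simp
    qed
    assume z: "z \<in> infinite_cone Y"
    show "?w p z \<le> ?w p q + ?w q z"
    proof (rule le[OF pq(1) z])
      fix \<delta> assume \<delta>: "\<delta> \<in> warping_metrics S \<phi> Y"
      show "\<delta> p z \<le> ?w p q + ?w q z"
        using Metric_space.triangle[OF MS[OF \<delta>] pq z] ge[OF \<delta> pq] ge[OF \<delta> pq(2) z] by linarith
    qed
  qed
  moreover have "?w p q \<le> cone_dist Y p q" if "p \<in> infinite_cone Y" "q \<in> infinite_cone Y" for p q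
    using that by (intro le) (auto simp: warping_metrics_def)
  moreover have "?w p (cone_action \<phi> s p) \<le> 1" if "p \<in> infinite_cone Y" "s \<in> S" for p s
  proof -
    have "cone_action \<phi> s p \<in> infinite_cone Y"
      using that assms(3)[of s] by (auto simp: infinite_cone_def cone_action_def)
    then show ?thesis using that by (intro le) (auto simp: warping_metrics_def)
  qed
  ultimately show ?thesis by (simp add: warping_metrics_def)
qed


section \<open>Coarse embeddings\<close>

definition coarse_embedding ::
  "'x set \<Rightarrow> ('x \<Rightarrow> 'x \<Rightarrow> real) \<Rightarrow> 'z set \<Rightarrow> ('z \<Rightarrow> 'z \<Rightarrow> real) \<Rightarrow> ('x \<Rightarrow> 'z) \<Rightarrow> bool"
  where "coarse_embedding X dX Z dZ f \<longleftrightarrow>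
    f ` X \<subseteq> Z \<and>
    (\<exists>\<rho>1 \<rho>2 :: real \<Rightarrow> real.
      (\<forall>\<rho>\<in>{\<rho>1, \<rho>2}. \<rho> ` {0..} \<subseteq> {0..} \<and> mono_on {0..} \<rho> \<and> \<not> bdd_above (\<rho> ` {0..})) \<and>
      (\<forall>x\<in>X. \<forall>x'\<in>X. \<rho>1 (dX x x') \<le> dZ (f x) (f x') \<and> dZ (f x) (f x') \<le> \<rho>2 (dX x x')))"


section \<open>A-T-menable actions\<close>

definition cond_negative_definite ::
  "('g, 'm) monoid_scheme \<Rightarrow> 'a set \<Rightarrow> ('g \<Rightarrow> 'a \<Rightarrow> 'a) \<Rightarrow> ('g \<times> 'a \<Rightarrow> real) \<Rightarrow> bool"
  where "cond_negative_definite G Y \<phi> h \<longleftrightarrow>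
    (\<forall>y\<in>Y. \<forall>c :: 'g \<Rightarrow> real. let F = {g \<in> carrier G. c g \<noteq> 0} in
      finite F \<longrightarrow> (\<Sum>g\<in>F. c g) = 0 \<longrightarrow>
      (\<Sum>g\<in>F. \<Sum>g'\<in>F. c g * c g' * h (g' \<otimes>\<^bsub>G\<^esub> inv\<^bsub>G\<^esub> g, \<phi> g y)) \<le> 0)"

definition a_T_menable_action ::
  "('g, 'm) monoid_scheme \<Rightarrow> 'a::topological_space set \<Rightarrow> ('g \<Rightarrow> 'a \<Rightarrow> 'a) \<Rightarrow> bool"
  where "a_T_menable_action G Y \<phi> \<longleftrightarrow>
    (\<exists>h. let GY = prod_topology (discrete_topology (carrier G)) (top_of_set Y) in
      continuous_map GY (top_of_set {0..}) h \<and>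
      (\<forall>g\<in>carrier G. \<forall>y\<in>Y. h (g, y) = h (inv\<^bsub>G\<^esub> g, \<phi> g y)) \<and>
      (\<forall>y\<in>Y. h (\<one>\<^bsub>G\<^esub>, y) = 0) \<and>
      proper_map GY (top_of_set {0..}) h \<and>
      cond_negative_definite G Y \<phi> h)"

end

theory Submission
  imports Defs
begin

text \<open>
  Let \<open>f\<close> be a coarse embedding of the warped cone into a Hilbert space, with lower and upper
  control functions \<open>\<rho>1\<close> and \<open>\<rho>2\<close>. On the level \<open>{r} \<times> Y\<close> the kernel
  \<open>\<parallel>f (r, y) - f (r, \<gamma> y)\<parallel>\<^sup>2\<close> is symmetric, normalised and conditionally negative-definite.
  A function \<open>h\<close> witnessing a-T-menability is built from countably many such levels, and two
  obstacles have to be overcome: \<open>f\<close> need not be continuous, and a single level sees only finitely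
  many group elements.

  Continuity is cheap. Points of the level \<open>r\<close> at \<open>Y\<close>-distance below \<open>1 / r\<close> are at warped distance
  at most \<open>1\<close>, so averaging \<open>f (r, _)\<close> against a partition of unity yields a continuous map \<open>F r\<close> on
  \<open>Y\<close> that stays within \<open>C = \<rho>2 1\<close> of it (\<open>continuous_approximation\<close>). Replacing \<open>f\<close> by \<open>F r\<close>
  changes distances by at most \<open>2 * C\<close>.

  As to the size, an element \<open>\<gamma>\<close> of word length at most \<open>k\<close> moves every point of the warped cone by
  at most \<open>k\<close> (\<open>wd_word_ball\<close>), uniformly in \<open>r\<close>. Conversely, for a finite set of elements of
  length greater than \<open>N\<close>, freeness and compactness imply that these move every point of a
  sufficiently high level by at least \<open>N\<close> (\<open>displacement_large\<close>): a cheaper route from \<open>(r, y)\<close> to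
  \<open>(r, \<gamma> y)\<close> would use at most \<open>N\<close> generators and, for large \<open>r\<close>, hardly any movement in \<open>Y\<close>, so it
  would end near \<open>w y\<close> for some word \<open>w\<close> of length at most \<open>N\<close>, while \<open>w y\<close> and \<open>\<gamma> y\<close> are separated
  uniformly in \<open>y\<close>.

  The kernels need not converge as \<open>r\<close> tends to infinity, nor need the maps \<open>F r\<close> be
  equicontinuous, so \<open>h\<close> is not obtained as a limit. Instead one takes
  \<open>h (\<gamma>, y) = (\<Sum>n. 2\<^sup>-\<^sup>n * \<parallel>F (r n) y - F (r n) (\<gamma> y)\<parallel>\<^sup>2)\<close>.
  The squared displacements are bounded for each \<open>\<gamma>\<close>, so the series converges uniformly in \<open>y\<close> and
  \<open>h\<close> is continuous. The weights are known in advance, so one first picks radii \<open>N n\<close>, increasing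
  to infinity, with \<open>\<rho>1 \<ge> 2\<^sup>n + 2 * C\<close> beyond \<open>N n\<close>, and only then a level \<open>r n\<close> so high that all
  \<open>\<gamma>\<close> of length greater than \<open>N n\<close> and at most \<open>N (n + 1)\<close> have displacement at least \<open>N n\<close>
  there. For such \<open>\<gamma>\<close> the \<open>n\<close>-th summand alone is at least \<open>2\<^sup>-\<^sup>n * (2\<^sup>n)\<^sup>2 = 2\<^sup>n\<close>. Outside the
  finite ball of radius \<open>N m\<close> every element lies in such an annulus with \<open>n \<ge> m\<close>, so \<open>h\<close> is proper
  (\<open>a_T_menable_action_series\<close>).
\<close>

section \<open>Continuous approximation of large-scale maps\<close>

text \<open>
  The map \<open>F\<close> averages the values of \<open>f\<close> on a finite \<open>\<epsilon>\<close>-net with the tent functions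
  \<open>max 0 (\<epsilon> - dist x y)\<close> as weights. Only net points \<open>\<epsilon>\<close>-close to \<open>y\<close> contribute to \<open>F y\<close>, and the
  values of \<open>f\<close> there lie in the convex ball of radius \<open>C\<close> around \<open>f y\<close>.
\<close>
lemma continuous_approximation:
  fixes f :: "'a::metric_space \<Rightarrow> 'b::real_normed_vector"
  assumes "compact Y" "0 < \<epsilon>"
    and close: "\<And>x y. x \<in> Y \<Longrightarrow> y \<in> Y \<Longrightarrow> dist x y < \<epsilon> \<Longrightarrow> dist (f x) (f y) \<le> C"
  obtains F where "continuous_on Y F" "\<And>y. y \<in> Y \<Longrightarrow> dist (F y) (f y) \<le> C"
proof -
  obtain N where N: "finite N" "N \<subseteq> Y" "Y \<subseteq> (\<Union>x\<in>N. ball x \<epsilon>)"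
    using seq_compact_imp_totally_bounded[OF compact_imp_seq_compact[OF assms(1)]] assms(2) by meson
  define b where "b x y = max 0 (\<epsilon> - dist x y)" for x y :: 'a
  define w where "w y = (\<Sum>x\<in>N. b x y)" for y
  define F where "F y = (\<Sum>x\<in>N. (b x y / w y) *\<^sub>R f x)" for y
  have b: "0 \<le> b x y" for x y by (simp add: b_def)
  have w: "0 < w y" if "y \<in> Y" for y
  proof -
    obtain x where "x \<in> N" "dist x y < \<epsilon>" using N(3) \<open>y \<in> Y\<close> by auto
    then show ?thesis unfolding w_def using N(1) b
      by (intro sum_pos2[of N x]) (auto simp: b_def)
  qed
  have "continuous_on Y F"
    unfolding F_def w_def using w
    by (intro continuous_intros) (auto simp: b_def w_def less_imp_neq[symmetric] intro!: continuous_intros)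
  moreover have "dist (F y) (f y) \<le> C" if y: "y \<in> Y" for y
  proof -
    have one: "(\<Sum>x\<in>N. b x y / w y) = 1"
      using w[OF y] by (simp add: w_def flip: sum_divide_distrib)
    have "F y - f y = (\<Sum>x\<in>N. (b x y / w y) *\<^sub>R (f x - f y))"
      by (simp add: F_def algebra_simps sum_subtractf one flip: scaleR_sum_left)
    also have "norm \<dots> \<le> (\<Sum>x\<in>N. (b x y / w y) * C)"
    proof (rule sum_norm_le)
      fix x assume "x \<in> N"
      show "norm ((b x y / w y) *\<^sub>R (f x - f y)) \<le> (b x y / w y) * C"
      proof (cases "dist x y < \<epsilon>")
        case True
        then have "norm (f x - f y) \<le> C"
          using close[of x y] \<open>x \<in> N\<close> N(2) y by (auto simp: dist_norm)
        then show ?thesis using b[of x y] w[OF y]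
          by (simp add: mult_left_mono divide_right_mono)
      qed (simp add: b_def)
    qed
    also have "\<dots> = C" unfolding sum_distrib_right[symmetric] one by simp
    finally show ?thesis by (simp add: dist_norm)
  qed
  ultimately show thesis by (rule that)
qed

section \<open>Negative-definite kernels and proper maps\<close>

text \<open>
  Expanding the squared distances, the terms with \<open>(norm (a i))\<^sup>2\<close> and \<open>(norm (a j))\<^sup>2\<close> vanish since
  the coefficients sum to zero. This is what makes squared Hilbert distances conditionally
  negative-definite.
\<close>
lemma sum_dist_squared:
  fixes a :: "'i \<Rightarrow> 'h::real_inner" and c :: "'i \<Rightarrow> real"
  assumes "(\<Sum>i\<in>I. c i) = 0"
  shows "(\<Sum>i\<in>I. \<Sum>j\<in>I. c i * c j * (dist (a i) (a j))\<^sup>2) = - 2 * (norm (\<Sum>i\<in>I. c i *\<^sub>R a i))\<^sup>2"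
proof -
  have "(\<Sum>i\<in>I. \<Sum>j\<in>I. c i * c j * (dist (a i) (a j))\<^sup>2)
      = (\<Sum>i\<in>I. \<Sum>j\<in>I. (c i * (norm (a i))\<^sup>2) * c j + c i * (c j * (norm (a j))\<^sup>2)
          - 2 * (c i * c j * (a i \<bullet> a j)))"
    by (intro sum.cong refl)
      (simp add: dist_norm power2_norm_eq_inner inner_diff inner_commute algebra_simps)
  also have "\<dots> = - 2 * (\<Sum>i\<in>I. \<Sum>j\<in>I. c i * c j * (a i \<bullet> a j))"
    by (simp add: sum.distrib sum_subtractf assms
        flip: sum_distrib_left sum_distrib_right)
  also have "(\<Sum>i\<in>I. \<Sum>j\<in>I. c i * c j * (a i \<bullet> a j)) = (norm (\<Sum>i\<in>I. c i *\<^sub>R a i))\<^sup>2"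
    by (simp add: power2_norm_eq_inner inner_sum_left inner_sum_right sum_distrib_left
        inner_commute mult.assoc mult.left_commute)
  finally show ?thesis .
qed

lemma continuous_map_prod_discrete:
  assumes "\<And>g. g \<in> A \<Longrightarrow> continuous_map X Z (\<lambda>x. h (g, x))"
  shows "continuous_map (prod_topology (discrete_topology A) X) Z h"
  unfolding continuous_map_def
proof (intro conjI allI impI)
  show "h \<in> topspace (prod_topology (discrete_topology A) X) \<rightarrow> topspace Z"
    using assms by (fastforce simp: continuous_map_def)
  fix U assume U: "openin Z U"
  have "{p \<in> topspace (prod_topology (discrete_topology A) X). h p \<in> U}
      = (\<Union>g\<in>A. {g} \<times> {x \<in> topspace X. h (g, x) \<in> U})"
    by auto
  also have "openin (prod_topology (discrete_topology A) X) \<dots>"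
    using assms U by (intro openin_Union) (auto simp: openin_prod_Times_iff continuous_map_def)
  finally show "openin (prod_topology (discrete_topology A) X)
      {p \<in> topspace (prod_topology (discrete_topology A) X). h p \<in> U}" .
qed

text \<open>
  The hypothesis \<open>large\<close> traps the preimage of a bounded set in \<open>F \<times> Y\<close> with \<open>F\<close> finite, which is
  compact; and for maps into a metrizable space, compact preimages of compact sets are enough for
  properness.
\<close>
lemma proper_map_prod_discrete:
  fixes h :: "'g \<times> 'a::topological_space \<Rightarrow> real"
  assumes "compact Y"
    and cont: "continuous_map (prod_topology (discrete_topology A) (top_of_set Y)) (top_of_set {0..}) h"
    and large: "\<And>M. \<exists>F. finite F \<and> F \<subseteq> A \<and> (\<forall>g\<in>A - F. \<forall>y\<in>Y. M < h (g, y))"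
  shows "proper_map (prod_topology (discrete_topology A) (top_of_set Y)) (top_of_set {0..}) h"
proof -
  let ?P = "prod_topology (discrete_topology A) (top_of_set Y)"
  have k: "k_space (top_of_set {0::real..})"
    by (intro metrizable_imp_k_space metrizable_space_subtopology metrizable_space_euclidean)
  have kc: "kc_space (top_of_set {0::real..})"
    by (intro Hausdorff_imp_kc_space Hausdorff_space_subtopology Hausdorff_space_euclidean)
  have "compactin ?P {p \<in> topspace ?P. h p \<in> K}" if K: "compactin (top_of_set {0..}) K" for K
  proof -
    have cK: "compact K" using K by (simp add: compactin_subtopology)
    then obtain M where M: "\<And>x. x \<in> K \<Longrightarrow> x \<le> M"
      using bounded_imp_bdd_above[OF compact_imp_bounded] by (meson bdd_above.E)
    obtain F where F: "finite F" "F \<subseteq> A" "\<And>g y. g \<in> A - F \<Longrightarrow> y \<in> Y \<Longrightarrow> M < h (g, y)"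
      using large[of M] by blast
    have "compactin ?P (F \<times> Y)"
      using F(1,2) \<open>compact Y\<close>
      by (auto simp: compactin_Times compactin_discrete_topology compactin_subtopology)
    moreover have "closedin ?P {p \<in> topspace ?P. h p \<in> K}"
      using cont compactin_imp_closedin_gen[OF kc K] by (rule closedin_continuous_map_preimage)
    moreover have "{p \<in> topspace ?P. h p \<in> K} \<subseteq> F \<times> Y"
      using F(3) M by (auto simp: not_less[symmetric])
    ultimately show ?thesis by (blast intro: closed_compactin)
  qed
  then show ?thesis
    unfolding proper_eq_compact_map[OF k kc disjI1[OF cont]]
    using cont by (auto simp: continuous_map_def)
qed

text \<open>
  Infinitely many kernels, each large on a part of the group only, combine into one proper kernel.
  The weights \<open>1 / 2 ^ n\<close> make the series of squared displacements converge, and a displacement of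
  \<open>2 ^ n\<close> in the \<open>n\<close>-th map still contributes \<open>(2 ^ n)\<^sup>2 / 2 ^ n = 2 ^ n\<close> to it. Hence \<open>lower\<close> only
  asks that some map with a large index displaces all points by that much, and this index may
  depend on \<open>g\<close>.
\<close>
lemma a_T_menable_action_series:
  fixes F :: "nat \<Rightarrow> 'a::topological_space \<Rightarrow> 'h::real_inner"
  assumes "continuous_action G Y \<phi>" "compact Y"
    and contF: "\<And>n. continuous_on Y (F n)"
    and upper: "\<And>g. g \<in> carrier G \<Longrightarrow> \<exists>B. \<forall>n. \<forall>y\<in>Y. dist (F n y) (F n (\<phi> g y)) \<le> B"
    and lower: "\<And>m. \<exists>K. finite K \<and> K \<subseteq> carrier G \<and>
      (\<forall>g\<in>carrier G - K. \<exists>n\<ge>m. \<forall>y\<in>Y. 2 ^ n \<le> dist (F n y) (F n (\<phi> g y)))"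
  shows "a_T_menable_action G Y \<phi>"
proof -
  interpret group_action G Y \<phi> using assms(1) by (simp add: continuous_action_def)
  interpret group G using group_hom by (simp add: group_hom_def)
  have cont\<phi>: "continuous_on Y (\<phi> g)" if "g \<in> carrier G" for g
    using assms(1) that by (simp add: continuous_action_def)
  have img: "\<phi> g y \<in> Y" if "g \<in> carrier G" "y \<in> Y" for g y
    using element_image that by blast
  define t where "t n g y = (dist (F n y) (F n (\<phi> g y)))\<^sup>2 / 2 ^ n" for n g y
  define h where "h = (\<lambda>(g, y). \<Sum>n. t n g y)"
  have t0: "0 \<le> t n g y" for n g y by (simp add: t_def)
  obtain B where B: "\<And>g n y. g \<in> carrier G \<Longrightarrow> y \<in> Y \<Longrightarrow> dist (F n y) (F n (\<phi> g y)) \<le> B g"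
    using upper by metis
  have t_le: "t n g y \<le> (B g)\<^sup>2 * (1 / 2) ^ n" if "g \<in> carrier G" "y \<in> Y" for n g y
    using power_mono[OF B[OF that] zero_le_dist, of n 2]
    by (simp add: t_def power_one_over field_simps)
  have geo: "summable (\<lambda>n. (B g)\<^sup>2 * (1 / 2) ^ n)" for g
    by (intro summable_mult summable_geometric) simp
  have sums: "(\<lambda>n. t n g y) sums h (g, y)" if "g \<in> carrier G" "y \<in> Y" for g y
    unfolding h_def prod.case
    using summable_comparison_test'[OF geo, of 0 "\<lambda>n. t n g y" g] t_le[OF that] t0
    by (simp add: summable_sums)
  have h0: "0 \<le> h (g, y)" if "g \<in> carrier G" "y \<in> Y" for g y
    using sums_le[OF _ sums_zero sums[OF that]] t0 by simp
  have t_le_h: "t n g y \<le> h (g, y)" if "g \<in> carrier G" "y \<in> Y" for n g y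
    using sum_le_suminf[OF sums_summable[OF sums[OF that]], of "{n}"] t0
    by (simp add: h_def)
  let ?P = "prod_topology (discrete_topology (carrier G)) (top_of_set Y)"
  have contg: "continuous_on Y (\<lambda>y. h (g, y))" if g: "g \<in> carrier G" for g
  proof -
    have ul: "uniform_limit Y (\<lambda>n y. \<Sum>i<n. t i g y) (\<lambda>y. h (g, y)) sequentially"
      unfolding h_def prod.case using t_le[OF g] t0
      by (intro Weierstrass_m_test[OF _ geo]) auto
    have "continuous_on Y (\<lambda>y. \<Sum>i<n. t i g y)" for n
    proof -
      have "continuous_on Y (\<lambda>y. F i (\<phi> g y))" for i
        using continuous_on_compose2[OF contF cont\<phi>[OF g]] img[OF g] by blast
      then show ?thesis unfolding t_def by (intro continuous_intros contF) auto
    qed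
    then show ?thesis by (intro uniform_limit_theorem[OF _ ul]) auto
  qed
  have cont: "continuous_map ?P (top_of_set {0..}) h"
    using contg h0 by (intro continuous_map_prod_discrete) (auto simp: continuous_map_in_subtopology)
  have "proper_map ?P (top_of_set {0..}) h"
  proof (rule proper_map_prod_discrete[OF \<open>compact Y\<close> cont])
    fix M :: real
    obtain m where m: "M < 2 ^ m" using real_arch_pow[of 2 M] by auto
    obtain K where K: "finite K" "K \<subseteq> carrier G" "\<And>g. g \<in> carrier G - K \<Longrightarrow>
        \<exists>n\<ge>m. \<forall>y\<in>Y. 2 ^ n \<le> dist (F n y) (F n (\<phi> g y))"
      using lower[of m] by blast
    have "M < h (g, y)" if g: "g \<in> carrier G - K" and y: "y \<in> Y" for g y
    proof -
      obtain n where n: "m \<le> n" "2 ^ n \<le> dist (F n y) (F n (\<phi> g y))" using K(3)[OF g] y by blast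
      have "(2::real) ^ m \<le> (2 ^ n)\<^sup>2 / 2 ^ n" using n(1) by (simp add: power2_eq_square)
      also have "\<dots> \<le> t n g y"
        unfolding t_def using n(2) by (intro divide_right_mono power_mono) auto
      finally show ?thesis using m t_le_h[of g y n] g y by simp
    qed
    then show "\<exists>K. finite K \<and> K \<subseteq> carrier G \<and> (\<forall>g\<in>carrier G - K. \<forall>y\<in>Y. M < h (g, y))"
      using K(1,2) by blast
  qed
  moreover have "h (g, y) = h (inv\<^bsub>G\<^esub> g, \<phi> g y)" if "g \<in> carrier G" "y \<in> Y" for g y
    using orbit_sym_aux[OF that refl] by (simp add: h_def t_def dist_commute)
  moreover have "h (\<one>\<^bsub>G\<^esub>, y) = 0" if "y \<in> Y" for y
    using that by (simp add: h_def t_def flip: id_eq_one)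
  moreover have "cond_negative_definite G Y \<phi> h"
    unfolding cond_negative_definite_def Let_def
  proof (intro ballI allI impI)
    fix y and c :: "'b \<Rightarrow> real"
    assume y: "y \<in> Y"
    let ?I = "{g \<in> carrier G. c g \<noteq> 0}"
    assume c: "(\<Sum>g\<in>?I. c g) = 0"
    have "(\<lambda>n. \<Sum>g\<in>?I. \<Sum>g'\<in>?I. c g * c g' * t n (g' \<otimes>\<^bsub>G\<^esub> inv\<^bsub>G\<^esub> g) (\<phi> g y))
        sums (\<Sum>g\<in>?I. \<Sum>g'\<in>?I. c g * c g' * h (g' \<otimes>\<^bsub>G\<^esub> inv\<^bsub>G\<^esub> g, \<phi> g y))"
      using y by (intro sums_sum sums_mult sums) (auto intro: img)
    moreover have "(\<Sum>g\<in>?I. \<Sum>g'\<in>?I. c g * c g' * t n (g' \<otimes>\<^bsub>G\<^esub> inv\<^bsub>G\<^esub> g) (\<phi> g y)) \<le> 0" for n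
    proof -
      have "\<phi> (g' \<otimes>\<^bsub>G\<^esub> inv\<^bsub>G\<^esub> g) (\<phi> g y) = \<phi> g' y" if "g \<in> ?I" "g' \<in> ?I" for g g'
        using that y composition_rule[of "\<phi> g y" g' "inv\<^bsub>G\<^esub> g"] orbit_sym_aux[of g y] img by simp
      then have "(\<Sum>g\<in>?I. \<Sum>g'\<in>?I. c g * c g' * t n (g' \<otimes>\<^bsub>G\<^esub> inv\<^bsub>G\<^esub> g) (\<phi> g y))
          = (\<Sum>g\<in>?I. \<Sum>g'\<in>?I. c g * c g' * (dist (F n (\<phi> g y)) (F n (\<phi> g' y)))\<^sup>2) / 2 ^ n"
        unfolding sum_divide_distrib by (intro sum.cong refl) (simp add: t_def)
      also have "\<dots> \<le> 0"
        unfolding sum_dist_squared[OF c] by (simp add: divide_le_0_iff)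
      finally show ?thesis .
    qed
    ultimately show "(\<Sum>g\<in>?I. \<Sum>g'\<in>?I. c g * c g' * h (g' \<otimes>\<^bsub>G\<^esub> inv\<^bsub>G\<^esub> g, \<phi> g y)) \<le> 0"
      by (rule sums_le[OF _ _ sums_zero, rotated]) 
  qed
  ultimately show ?thesis
    unfolding a_T_menable_action_def Let_def using cont by blast
qed

section \<open>Displacement in the warped cone\<close>

locale warped_cone = group_action G Y \<phi> + group G
  for G (structure) and Y :: "'a::metric_space set" and \<phi> +
  fixes S
  assumes S: "S \<subseteq> carrier G" "finite S" "generate G S = carrier G"
    and Y: "compact Y" "0 < diameter Y"
    and continuous: "\<And>g. g \<in> carrier G \<Longrightarrow> continuous_on Y (\<phi> g)"
begin

abbreviation "OY \<equiv> infinite_cone Y"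
abbreviation "wd \<equiv> warped_dist S \<phi> Y"

text \<open>
  Including \<open>\<one>\<close> among the letters makes words of length exactly \<open>n\<close> and of length at most \<open>n\<close>
  represent the same elements.
\<close>
abbreviation "T \<equiv> insert \<one> (S \<union> m_inv G ` S)"

primrec word_ball :: "nat \<Rightarrow> 'b set" where
  "word_ball 0 = {\<one>}"
| "word_ball (Suc n) = (\<lambda>(t, w). t \<otimes> w) ` (T \<times> word_ball n)"

lemma T_carrier: "T \<subseteq> carrier G"
  using S(1) by auto

lemma word_ball_carrier: "word_ball n \<subseteq> carrier G"
  using T_carrier by (induction n) auto

lemma finite_word_ball: "finite (word_ball n)"
  using S(2) by (induction n) auto

lemma word_ball_mono: "m \<le> n \<Longrightarrow> word_ball m \<subseteq> word_ball n"
proof (induction rule: dec_induct)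
  case (step n)
  have "w \<in> word_ball (Suc n)" if "w \<in> word_ball n" for w
    using that word_ball_carrier[of n] by (auto intro!: image_eqI[of _ _ "(\<one>, w)"])
  with step show ?case by blast
qed simp

lemma word_ball_mult: "v \<in> word_ball m \<Longrightarrow> w \<in> word_ball n \<Longrightarrow> v \<otimes> w \<in> word_ball (m + n)"
proof (induction m arbitrary: v)
  case 0
  then show ?case using word_ball_carrier[of n] by auto
next
  case (Suc m)
  then obtain t u where "v = t \<otimes> u" "t \<in> T" "u \<in> word_ball m" by auto
  moreover from this have "t \<in> carrier G" "u \<in> carrier G" "w \<in> carrier G"
    using T_carrier word_ball_carrier Suc.prems(2) by blast+
  ultimately have "v \<otimes> w = t \<otimes> (u \<otimes> w)" "t \<in> T" "u \<in> word_ball m"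
    by (simp_all add: m_assoc)
  then show ?case using Suc.IH[of u] Suc.prems(2)
    by (auto intro!: image_eqI[of _ _ "(t, u \<otimes> w)"])
qed

lemma word_ball_exhausts:
  assumes "g \<in> carrier G"
  shows "\<exists>n. g \<in> word_ball n"
proof -
  have one: "t \<in> word_ball 1" if "t \<in> T" for t
    using that T_carrier by (auto intro!: image_eqI[of _ _ "(t, \<one>)"])
  have "g \<in> generate G S" using assms S(3) by simp
  then show ?thesis
  proof induction
    case (eng g1 g2)
    then show ?case using word_ball_mult by blast
  qed (use one in blast)+
qed

lemma bounded_Y: "bounded Y" using Y(1) compact_imp_bounded by blast

lemma warped: "wd \<in> warping_metrics S \<phi> Y"
  using S(1) surj_prop by (intro warped_dist_in_warping_metrics bounded_Y Y(2)) auto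

lemma Metric_space_wd: "Metric_space OY wd"
  using warped by (simp add: warping_metrics_def)

lemmas wd_nonneg = Metric_space.nonneg[OF Metric_space_wd]
  and wd_commute = Metric_space.commute[OF Metric_space_wd]
  and wd_zero = Metric_space.zero[OF Metric_space_wd]
  and wd_triangle = Metric_space.triangle[OF Metric_space_wd]

lemma wd_refl: "p \<in> OY \<Longrightarrow> wd p p = 0"
  by (simp add: wd_zero)

lemma cone_action_cone: "g \<in> carrier G \<Longrightarrow> p \<in> OY \<Longrightarrow> cone_action \<phi> g p \<in> OY"
  using element_image by (auto simp: cone_action_def infinite_cone_def)

lemma cone_action_one: "p \<in> OY \<Longrightarrow> cone_action \<phi> \<one> p = p"
  by (auto simp: cone_action_def infinite_cone_def simp flip: id_eq_one)

lemma action_inv: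
  assumes "g \<in> carrier G" "y \<in> Y"
  shows "\<phi> g (\<phi> (inv g) y) = y"
  using assms orbit_sym_aux[of "inv g" y] by simp

lemma cone_action_inv:
  assumes "g \<in> carrier G" "p \<in> OY"
  shows "cone_action \<phi> g (cone_action \<phi> (inv g) p) = p"
  using assms action_inv by (auto simp: cone_action_def infinite_cone_def)

lemma wd_step:
  assumes "t \<in> T" "p \<in> OY"
  shows "wd p (cone_action \<phi> t p) \<le> 1"
proof -
  have gen: "wd q (cone_action \<phi> s q) \<le> 1" if "s \<in> S" "q \<in> OY" for s q
    using that warped by (simp add: warping_metrics_def)
  consider "t = \<one>" | "t \<in> S" | s where "s \<in> S" "t = inv s" using assms(1) by auto
  then show ?thesis
  proof cases
    case 1
    then show ?thesis using assms(2) by (simp add: cone_action_one wd_refl)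
  next
    case 3
    moreover have "s \<in> carrier G" using 3(1) S(1) by auto
    ultimately show ?thesis using gen[of s "cone_action \<phi> t p"] assms(2)
      by (simp add: cone_action_inv cone_action_cone wd_commute)
  qed (use gen assms(2) in blast)
qed

lemma wd_word_ball:
  assumes "g \<in> word_ball n" "p \<in> OY"
  shows "wd p (cone_action \<phi> g p) \<le> real n"
  using assms(1)
proof (induction n arbitrary: g)
  case 0
  then show ?case using assms(2) by (simp add: cone_action_one wd_refl)
next
  case (Suc n)
  then obtain t w where g: "g = t \<otimes> w" and t: "t \<in> T" and w: "w \<in> word_ball n" by auto
  have c: "t \<in> carrier G" "w \<in> carrier G" using t w T_carrier word_ball_carrier by auto
  then have "cone_action \<phi> g p = cone_action \<phi> t (cone_action \<phi> w p)"
    using assms(2) composition_rule by (auto simp: g cone_action_def infinite_cone_def)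
  moreover have "cone_action \<phi> w p \<in> OY" "cone_action \<phi> g p \<in> OY"
    using c assms(2) by (simp_all add: g cone_action_cone)
  ultimately show ?case
    using wd_triangle[of p "cone_action \<phi> w p" "cone_action \<phi> g p"] Suc.IH[OF w]
      wd_step[OF t, of "cone_action \<phi> w p"] assms(2) by simp
qed

text \<open>
  Lower bounds on the warped metric come from test functions that change by at most the cone
  distance along the cone and by at most \<open>1\<close> along a generator. The pseudometric induced by such a
  function satisfies the two warping constraints; taking the maximum with the warped metric itself
  turns it into a metric, to which maximality applies.
\<close>
lemma warped_dist_ge_lipschitz:
  fixes u :: "real \<times> 'a \<Rightarrow> real"
  assumes lip: "\<And>p q. p \<in> OY \<Longrightarrow> q \<in> OY \<Longrightarrow> u q \<le> u p + cone_dist Y p q"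
    and step: "\<And>p s. p \<in> OY \<Longrightarrow> s \<in> S \<Longrightarrow> \<bar>u p - u (cone_action \<phi> s p)\<bar> \<le> 1"
    and "p \<in> OY" "q \<in> OY"
  shows "\<bar>u p - u q\<bar> \<le> wd p q"
proof -
  define \<delta> where "\<delta> p q = max \<bar>u p - u q\<bar> (wd p q)" for p q
  have "Metric_space OY \<delta>"
  proof
    fix x y z
    show "0 \<le> \<delta> x y" by (simp add: \<delta>_def)
    show "\<delta> x y = \<delta> y x" by (simp add: \<delta>_def wd_commute abs_minus_commute)
    assume xy: "x \<in> OY" "y \<in> OY"
    show "\<delta> x y = 0 \<longleftrightarrow> x = y"
      using wd_zero[OF xy] wd_nonneg[of x y] by (auto simp: \<delta>_def max_def split: if_splits)
    assume "z \<in> OY"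
    then show "\<delta> x z \<le> \<delta> x y + \<delta> y z"
      using wd_triangle[OF xy, of z] by (auto simp: \<delta>_def max_def)
  qed
  moreover have "\<delta> x y \<le> cone_dist Y x y" if "x \<in> OY" "y \<in> OY" for x y
  proof -
    have "cone_dist Y y x = cone_dist Y x y"
      by (simp add: cone_dist_def dist_commute min.commute abs_minus_commute)
    moreover have "wd x y \<le> cone_dist Y x y" using warped that by (simp add: warping_metrics_def)
    ultimately show ?thesis using lip[OF that] lip[OF that(2,1)] by (simp add: \<delta>_def)
  qed
  moreover have "\<delta> x (cone_action \<phi> s x) \<le> 1" if "x \<in> OY" "s \<in> S" for x s
    using that step warped by (simp add: \<delta>_def warping_metrics_def)
  ultimately have "\<delta> \<in> warping_metrics S \<phi> Y"
    by (simp add: warping_metrics_def)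
  then show ?thesis
    using warping_metrics_le_warped_dist[of \<delta> S \<phi> Y p q] assms(3,4) by (simp add: \<delta>_def)
qed

text \<open>
  The chains from \<open>p\<close> that the warped metric minimises over: \<open>k\<close> counts the letters applied and
  \<open>e\<close> is the total cone distance of the jumps, so that the cost of the chain is \<open>k + e\<close>. The two
  parts are recorded separately because a bound on \<open>k\<close> limits the words that can occur, while
  \<open>e\<close> becomes negligible in \<open>Y\<close> on high levels.
\<close>
inductive chain :: "real \<times> 'a \<Rightarrow> nat \<Rightarrow> real \<Rightarrow> real \<times> 'a \<Rightarrow> bool" for p where
  start: "chain p 0 0 p"
| jump: "chain p k e q \<Longrightarrow> q' \<in> OY \<Longrightarrow> chain p k (e + cone_dist Y q q') q'"
| move: "chain p k e q \<Longrightarrow> t \<in> T \<Longrightarrow> chain p (Suc k) e (cone_action \<phi> t q)"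

lemma cone_dist_nonneg: "p \<in> OY \<Longrightarrow> q \<in> OY \<Longrightarrow> 0 \<le> cone_dist Y p q"
  using Y(2) by (auto simp: cone_dist_def infinite_cone_def)

lemma chain_cone: "chain p k e q \<Longrightarrow> p \<in> OY \<Longrightarrow> q \<in> OY \<and> 0 \<le> e"
  by (induction rule: chain.induct) (use T_carrier in \<open>auto simp: cone_dist_nonneg cone_action_cone\<close>)

text \<open>
  The infimal cost of a chain from \<open>p\<close> is a test function as in \<open>warped_dist_ge_lipschitz\<close>, because a
  chain can be prolonged by a jump or a letter. It vanishes at \<open>p\<close>, so its value at \<open>q\<close> is at most
  the warped distance.
\<close>
lemma chain_if_warped_dist_less:
  assumes p: "p \<in> OY" and q: "q \<in> OY" and D: "wd p q < D"
  shows "\<exists>k e. chain p k e q \<and> real k + e < D"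
proof -
  define costs where "costs x = {real k + e | k e. chain p k e x}" for x
  define u where "u x = Inf (costs x)" for x
  have bdd: "bdd_below (costs x)" for x
    by (intro bdd_belowI[of _ 0]) (auto simp: costs_def dest!: chain_cone[OF _ p])
  have ne: "costs x \<noteq> {}" if "x \<in> OY" for x
    using jump[OF start that, of p] by (auto simp: costs_def)
  have u_le: "u y \<le> u x + c" if "x \<in> OY" "\<And>a. a \<in> costs x \<Longrightarrow> a + c \<in> costs y" for x y c
  proof -
    have "u y - c \<le> u x"
      unfolding u_def[of x]
    proof (rule cInf_greatest[OF ne[OF that(1)]])
      fix a assume "a \<in> costs x"
      then have "u y \<le> a + c" unfolding u_def using that(2) bdd by (intro cInf_lower) auto
      then show "u y - c \<le> a" by simp
    qed
    then show ?thesis by simp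
  qed
  have u_step: "u (cone_action \<phi> t x) \<le> u x + 1" if "x \<in> OY" "t \<in> T" for x t
  proof (rule u_le[OF that(1)])
    fix a assume "a \<in> costs x"
    then obtain k e where "chain p k e x" "a + 1 = real (Suc k) + e" by (auto simp: costs_def)
    then show "a + 1 \<in> costs (cone_action \<phi> t x)"
      unfolding costs_def using move[OF _ that(2)] by blast
  qed
  have "\<bar>u p - u q\<bar> \<le> wd p q"
  proof (rule warped_dist_ge_lipschitz[OF _ _ p q])
    fix x y assume x: "x \<in> OY" and y: "y \<in> OY"
    show "u y \<le> u x + cone_dist Y x y"
    proof (rule u_le[OF x])
      fix a assume "a \<in> costs x"
      then obtain k e where "chain p k e x" "a + cone_dist Y x y = real k + (e + cone_dist Y x y)"
        by (auto simp: costs_def)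
      then show "a + cone_dist Y x y \<in> costs y"
        unfolding costs_def using jump[OF _ y] by blast
    qed
  next
    fix x s assume x: "x \<in> OY" and s: "s \<in> S"
    have "s \<in> carrier G" using s S(1) by auto
    then have "cone_action \<phi> (inv s) (cone_action \<phi> s x) = x"
      using cone_action_inv[of "inv s" x] x by simp
    then show "\<bar>u x - u (cone_action \<phi> s x)\<bar> \<le> 1"
      using u_step[of x s] u_step[of "cone_action \<phi> s x" "inv s"] x s
        cone_action_cone[OF \<open>s \<in> carrier G\<close> x] by auto
  qed
  moreover have "u p \<le> 0"
    unfolding u_def by (rule cInf_lower[OF _ bdd]) (force simp: costs_def intro: start)
  ultimately have "u q < D" using D by linarith
  then obtain a where "a \<in> costs q" "a < D"
    unfolding u_def using cInf_less_iff[OF ne[OF q] bdd] by blast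
  then show ?thesis by (auto simp: costs_def)
qed

text \<open>
  The factor \<open>2\<close> in front of \<open>\<eta>\<close> leaves room for two errors of size \<open>\<eta>\<close> in \<open>chain_shadows_word\<close>: the
  one inherited from earlier letters and the one caused by jumps.
\<close>
lemma uniform_modulus:
  assumes "0 < \<epsilon>"
  shows "\<exists>\<eta>>0. \<eta> \<le> \<epsilon> \<and> (\<forall>t\<in>T. \<forall>x\<in>Y. \<forall>y\<in>Y. dist x y \<le> 2 * \<eta> \<longrightarrow> dist (\<phi> t x) (\<phi> t y) \<le> \<epsilon>)"
proof -
  have "\<exists>d>0. \<forall>x\<in>Y. \<forall>y\<in>Y. dist x y < d \<longrightarrow> dist (\<phi> t x) (\<phi> t y) < \<epsilon>" if "t \<in> T" for t
  proof -
    have "uniformly_continuous_on Y (\<phi> t)"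
      using that T_carrier continuous Y(1) compact_uniformly_continuous by blast
    then show ?thesis using assms unfolding uniformly_continuous_on_def by (metis dist_commute)
  qed
  then obtain d where d: "\<And>t. t \<in> T \<Longrightarrow> 0 < d t"
    "\<And>t x y. t \<in> T \<Longrightarrow> x \<in> Y \<Longrightarrow> y \<in> Y \<Longrightarrow> dist x y < d t \<Longrightarrow> dist (\<phi> t x) (\<phi> t y) < \<epsilon>"
    by metis
  define \<eta> where "\<eta> = min \<epsilon> (Min (d ` T) / 3)"
  have fin: "finite (d ` T)" "d ` T \<noteq> {}" using S(2) by auto
  have pos: "0 < Min (d ` T)" using fin d(1) by (subst Min_gr_iff) auto
  have "2 * \<eta> < d t" if "t \<in> T" for t
  proof -
    have "Min (d ` T) \<le> d t" using that fin by (intro Min_le) auto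
    then show ?thesis using pos by (auto simp: \<eta>_def min_def)
  qed
  then have "\<forall>t\<in>T. \<forall>x\<in>Y. \<forall>y\<in>Y. dist x y \<le> 2 * \<eta> \<longrightarrow> dist (\<phi> t x) (\<phi> t y) \<le> \<epsilon>"
    by (meson d(2) le_less_trans less_imp_le)
  then show ?thesis using pos assms by (intro exI[of _ \<eta>]) (auto simp: \<eta>_def)
qed

text \<open>
  A chain of cost less than \<open>N\<close> that starts on a level \<open>r\<close> with \<open>r * diameter Y \<ge> 2 * N\<close> never
  descends below \<open>r / 2\<close>, so jumps of total cost \<open>e\<close> move its \<open>Y\<close>-coordinate by at most
  \<open>2 * e / r\<close>. Letters may magnify the distance to the pure word orbit, but there are fewer than \<open>N\<close>
  of them, so tolerances \<open>\<eta> 0 \<le> \<eta> 1 \<le> \<dots> \<le> \<eta> N = \<epsilon>\<close> chosen backwards from \<open>\<epsilon>\<close> absorb this.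
\<close>
lemma chain_shadows_word:
  assumes "0 < \<epsilon>"
  shows "\<exists>r0>0. \<forall>r\<ge>r0. \<forall>y\<in>Y. \<forall>k e q. chain (r, y) k e q \<longrightarrow> real k + e < real N \<longrightarrow>
    (\<exists>w\<in>word_ball k. dist (snd q) (\<phi> w y) \<le> 2 * \<epsilon>)"
proof -
  obtain m where m: "\<And>\<epsilon>. 0 < \<epsilon> \<Longrightarrow> 0 < m \<epsilon>" "\<And>\<epsilon>. 0 < \<epsilon> \<Longrightarrow> m \<epsilon> \<le> \<epsilon>"
    "\<And>\<epsilon> t x y. 0 < \<epsilon> \<Longrightarrow> t \<in> T \<Longrightarrow> x \<in> Y \<Longrightarrow> y \<in> Y \<Longrightarrow> dist x y \<le> 2 * m \<epsilon>
      \<Longrightarrow> dist (\<phi> t x) (\<phi> t y) \<le> \<epsilon>"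
    using uniform_modulus by metis
  define \<eta> where "\<eta> k = (m ^^ (N - k)) \<epsilon>" for k
  have pow: "0 < (m ^^ j) \<epsilon> \<and> (m ^^ j) \<epsilon> \<le> \<epsilon>" for j
    by (induction j) (use assms m(1,2) in \<open>auto intro: order_trans\<close>)
  have \<eta>_pos: "0 < \<eta> k" and \<eta>_le: "\<eta> k \<le> \<epsilon>" for k using pow by (auto simp: \<eta>_def)
  have \<eta>_Suc: "\<eta> k = m (\<eta> (Suc k))" if "k < N" for k
    using Suc_diff_Suc[OF that] by (metis \<eta>_def comp_apply funpow.simps(2))
  have \<eta>_0: "\<eta> 0 \<le> \<eta> k" if "k \<le> N" for k
    using that
  proof (induction k)
    case (Suc k)
    then show ?case using \<eta>_Suc[of k] m(2)[OF \<eta>_pos[of "Suc k"]] by simp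
  qed simp
  (* The first bound keeps chains above half the initial level, the last one makes the effect of
     all jumps together at most the smallest tolerance. *)
  define r0 where "r0 = max (2 * real N / diameter Y) (max 1 (2 * real N / \<eta> 0))"
  have "\<exists>w\<in>word_ball k. dist (snd q) (\<phi> w y) \<le> 2 * \<epsilon>"
    if r: "r0 \<le> r" and y: "y \<in> Y" and ch: "chain (r, y) k e q" and less: "real k + e < real N"
    for r y k e q
  proof -
    have rpos: "0 < r" using r by (auto simp: r0_def)
    have r1: "2 * real N \<le> r * diameter Y" and r2: "2 * real N \<le> r * \<eta> 0"
      using r Y(2) \<eta>_pos[of 0] by (auto simp: r0_def field_simps)
    have cone: "(r, y) \<in> OY" using rpos y by (simp add: infinite_cone_def)
    have budget: "2 * e / r \<le> \<eta> j" if "e \<le> real N" "j \<le> N" for e j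
    proof -
      have "2 * e / r \<le> \<eta> 0" using that(1) r2 rpos by (simp add: divide_le_eq mult.commute)
      then show ?thesis using \<eta>_0[OF that(2)] by linarith
    qed
    (* The jump error is kept apart from the tolerance \<eta> k, so that it is not charged again for
       every letter; it is merged with \<eta> k only when the next letter is applied. *)
    have "\<bar>fst q - r\<bar> * diameter Y \<le> e \<and> (\<exists>w\<in>word_ball k. dist (snd q) (\<phi> w y) \<le> \<eta> k + 2 * e / r)"
      using ch less
    proof (induction rule: chain.induct)
      case start
      then show ?case using y \<eta>_pos[of 0] by (simp flip: id_eq_one)
    next
      case (jump k e q q')
      have q: "q \<in> OY" "0 \<le> e" using chain_cone[OF jump.hyps(1) cone] by auto
      define c where "c = cone_dist Y q q'"
      have c0: "0 \<le> c" using cone_dist_nonneg[OF q(1) jump.hyps(2)] by (simp add: c_def)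
      have small: "e + c < real N" using jump.prems by (simp add: c_def)
      obtain w where w: "w \<in> word_ball k" "dist (snd q) (\<phi> w y) \<le> \<eta> k + 2 * e / r"
        and near: "\<bar>fst q - r\<bar> * diameter Y \<le> e"
        using jump.IH jump.prems c0 by (auto simp: c_def)
      have c_split: "\<bar>fst q - fst q'\<bar> * diameter Y + min (fst q) (fst q') * dist (snd q) (snd q') = c"
        by (simp add: c_def cone_dist_def)
      have "0 < min (fst q) (fst q')" using q(1) jump.hyps(2) by (auto simp: infinite_cone_def)
      then have "0 \<le> min (fst q) (fst q') * dist (snd q) (snd q')" by simp
      then have dr: "\<bar>fst q - fst q'\<bar> * diameter Y \<le> c" using c_split by linarith
      have "\<bar>fst q' - r\<bar> * diameter Y \<le> (\<bar>fst q - r\<bar> + \<bar>fst q - fst q'\<bar>) * diameter Y"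
        using Y(2) by (intro mult_right_mono) auto
      then have near': "\<bar>fst q' - r\<bar> * diameter Y \<le> e + c"
        using near dr by (simp add: distrib_right)
      have half: "r / 2 \<le> x" if "\<bar>x - r\<bar> * diameter Y \<le> e + c" for x
      proof -
        have "\<bar>x - r\<bar> * diameter Y \<le> (r / 2) * diameter Y" using that small r1 by simp
        then have "\<bar>x - r\<bar> \<le> r / 2" using Y(2) by simp
        then show ?thesis by linarith
      qed
      have "r / 2 \<le> min (fst q) (fst q')" using half near near' c0 by simp
      then have "(r / 2) * dist (snd q) (snd q') \<le> min (fst q) (fst q') * dist (snd q) (snd q')"
        by (intro mult_right_mono) auto
      also have "\<dots> \<le> c" using c_split Y(2) mult_nonneg_nonneg[of "\<bar>fst q - fst q'\<bar>" "diameter Y"] by linarith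
      finally have "dist (snd q) (snd q') \<le> 2 * c / r" using rpos by (simp add: field_simps)
      moreover have "dist (snd q') (\<phi> w y) \<le> dist (snd q) (snd q') + dist (snd q) (\<phi> w y)"
        by (metis dist_commute dist_triangle)
      ultimately have "dist (snd q') (\<phi> w y) \<le> \<eta> k + 2 * (e + c) / r"
        using w(2) by (simp add: add_divide_distrib distrib_left)
      then show ?case using near' w(1) unfolding c_def by blast
    next
      case (move k e q t)
      have q: "q \<in> OY" "0 \<le> e" using chain_cone[OF move.hyps(1) cone] by auto
      have k: "k < N" "Suc k \<le> N" "e \<le> real N" using move.prems q(2) by linarith+
      obtain w where w: "w \<in> word_ball k" "dist (snd q) (\<phi> w y) \<le> \<eta> k + 2 * e / r"
        and near: "\<bar>fst q - r\<bar> * diameter Y \<le> e"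
        using move.IH move.prems by auto
      have carr: "t \<in> carrier G" "w \<in> carrier G"
        using move.hyps(2) T_carrier w(1) word_ball_carrier by auto
      have "dist (snd q) (\<phi> w y) \<le> 2 * m (\<eta> (Suc k))"
        using w(2) budget[OF k(3), of k] k(1) \<eta>_Suc[OF k(1)] by simp
      moreover have "snd q \<in> Y" "\<phi> w y \<in> Y"
        using q(1) element_image[OF carr(2) y] by (auto simp: infinite_cone_def)
      ultimately have "dist (\<phi> t (snd q)) (\<phi> t (\<phi> w y)) \<le> \<eta> (Suc k)"
        using m(3)[OF \<eta>_pos move.hyps(2)] by blast
      then have "dist (snd (cone_action \<phi> t q)) (\<phi> (t \<otimes> w) y) \<le> \<eta> (Suc k) + 2 * e / r"
        using composition_rule[OF y carr] q(2) rpos by (simp add: cone_action_def add_increasing2)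
      moreover have "t \<otimes> w \<in> word_ball (Suc k)" using move.hyps(2) w(1) by force
      ultimately show ?case using near by (auto simp: cone_action_def)
    qed
    moreover have "e \<le> real N" "k \<le> N" using less chain_cone[OF ch cone] by linarith+
    moreover from this have "\<eta> k + 2 * e / r \<le> 2 * \<epsilon>" using budget[of e k] \<eta>_le[of k] by linarith
    ultimately show ?thesis by (meson order_trans)
  qed
  then show ?thesis by (intro exI[of _ r0]) (auto simp: r0_def)
qed

lemma free_orbit_separation:
  assumes "free_action G Y \<phi>" "v \<in> carrier G" "w \<in> carrier G" "v \<noteq> w"
  shows "\<exists>c>0. \<forall>y\<in>Y. c < dist (\<phi> v y) (\<phi> w y)"
proof (cases "Y = {}")
  case False
  have "continuous_on Y (\<lambda>y. dist (\<phi> v y) (\<phi> w y))"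
    by (intro continuous_on_dist continuous assms(2,3))
  then obtain y0 where y0: "y0 \<in> Y"
    "\<And>y. y \<in> Y \<Longrightarrow> dist (\<phi> v y0) (\<phi> w y0) \<le> dist (\<phi> v y) (\<phi> w y)"
    using continuous_attains_inf[OF Y(1) False] by blast
  have "\<phi> v y0 \<noteq> \<phi> w y0"
  proof
    assume eq: "\<phi> v y0 = \<phi> w y0"
    have "\<phi> (inv w \<otimes> v) y0 = \<phi> (inv w) (\<phi> w y0)"
      using composition_rule[of y0 "inv w" v] assms(2,3) y0(1) eq by simp
    also have "\<dots> = y0" using orbit_sym_aux[OF assms(3) y0(1) refl] .
    finally have "inv w \<otimes> v = \<one>"
      using assms y0(1) unfolding free_action_def by blast
    then show False using assms(2-4) by (metis inv_closed inv_equality inv_inv)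
  qed
  then have "0 < dist (\<phi> v y0) (\<phi> w y0)" by simp
  moreover have "\<forall>y\<in>Y. dist (\<phi> v y0) (\<phi> w y0) / 2 < dist (\<phi> v y) (\<phi> w y)"
  proof
    fix y assume "y \<in> Y"
    then show "dist (\<phi> v y0) (\<phi> w y0) / 2 < dist (\<phi> v y) (\<phi> w y)"
      using y0(2)[of y] \<open>0 < dist (\<phi> v y0) (\<phi> w y0)\<close> by linarith
  qed
  ultimately show ?thesis by (meson half_gt_zero)
qed (auto intro: exI[of _ 1])

text \<open>
  If \<open>wd (r, y) (r, \<phi> g y) < N\<close>, a chain of cost less than \<open>N\<close> joins the two points and places
  \<open>\<phi> g y\<close> close to \<open>\<phi> w y\<close> for some \<open>w\<close> in \<open>word_ball N\<close>. The finitely many pairs \<open>(g, w)\<close> are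
  separated by a common positive distance, which excludes this on high levels.
\<close>
lemma displacement_large:
  assumes "free_action G Y \<phi>" "finite E" "E \<subseteq> carrier G - word_ball N"
  shows "\<exists>r>0. \<forall>g\<in>E. \<forall>y\<in>Y. real N \<le> wd (r, y) (r, \<phi> g y)"
proof -
  have "\<forall>p\<in>E \<times> word_ball N. \<exists>c>0. \<forall>y\<in>Y. c < dist (\<phi> (fst p) y) (\<phi> (snd p) y)"
    using assms(3) word_ball_carrier[of N] by (intro ballI free_orbit_separation[OF assms(1)]) auto
  then obtain c where c: "\<And>p. p \<in> E \<times> word_ball N \<Longrightarrow> 0 < c p"
    "\<And>p y. p \<in> E \<times> word_ball N \<Longrightarrow> y \<in> Y \<Longrightarrow> c p < dist (\<phi> (fst p) y) (\<phi> (snd p) y)"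
    by metis
  define \<epsilon> where "\<epsilon> = Min (insert 1 (c ` (E \<times> word_ball N)))"
  have fin: "finite (insert 1 (c ` (E \<times> word_ball N)))" using assms(2) finite_word_ball by auto
  have "0 < \<epsilon>" unfolding \<epsilon>_def using fin c(1) by (subst Min_gr_iff) auto
  have sep: "\<epsilon> < dist (\<phi> g y) (\<phi> w y)" if "g \<in> E" "w \<in> word_ball N" "y \<in> Y" for g w y
  proof -
    have "\<epsilon> \<le> c (g, w)" unfolding \<epsilon>_def using fin that by (intro Min_le) auto
    then show ?thesis using c(2)[of "(g, w)" y] that by auto
  qed
  obtain r where r: "0 < r" "\<And>y k e q. y \<in> Y \<Longrightarrow> chain (r, y) k e q \<Longrightarrow> real k + e < real N \<Longrightarrow>
    \<exists>w\<in>word_ball k. dist (snd q) (\<phi> w y) \<le> \<epsilon>"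
    using chain_shadows_word[of "\<epsilon> / 2" N] \<open>0 < \<epsilon>\<close> by auto
  have "real N \<le> wd (r, y) (r, \<phi> g y)" if g: "g \<in> E" and y: "y \<in> Y" for g y
  proof (rule ccontr)
    assume "\<not> ?thesis"
    moreover have cone: "(r, y) \<in> OY" "(r, \<phi> g y) \<in> OY"
      using r(1) y element_image[of g y] g assms(3) by (auto simp: infinite_cone_def)
    ultimately obtain k e where ch: "chain (r, y) k e (r, \<phi> g y)" "real k + e < real N"
      using chain_if_warped_dist_less[of "(r, y)" "(r, \<phi> g y)" "real N"] by auto
    have "k \<le> N" using ch chain_cone[OF ch(1) cone(1)] by linarith
    then show False using r(2)[OF y ch] sep[OF g _ y] word_ball_mono by fastforce
  qed
  then show ?thesis using r(1) by blast
qed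

end

section \<open>Coarse embeddings yield a-T-menability\<close>

theorem theoremC:
  fixes G :: "('g, 'm) monoid_scheme"
    and S :: "'g set"
    and Y :: "'a::metric_space set"
    and \<phi> :: "'g \<Rightarrow> 'a \<Rightarrow> 'a"
    and f :: "real \<times> 'a \<Rightarrow> 'h::{real_inner, complete_space}"
  assumes "group G"
    and "S \<subseteq> carrier G" "finite S" "generate G S = carrier G"
    and "compact Y" "0 < diameter Y"
    and "continuous_action G Y \<phi>"
    and "free_action G Y \<phi>"
    and "coarse_embedding (infinite_cone Y) (warped_dist S \<phi> Y) (UNIV :: 'h set) dist f"
  shows "a_T_menable_action G Y \<phi>"
proof -
  interpret group_action G Y \<phi> using assms(7) by (simp add: continuous_action_def)
  have "continuous_on Y (\<phi> g)" if "g \<in> carrier G" for g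
    using assms(7) that by (simp add: continuous_action_def)
  then have "warped_cone_axioms G Y \<phi> S"
    unfolding warped_cone_axioms_def using assms(2-6) by blast
  then interpret warped_cone G Y \<phi> S
    by (rule warped_cone.intro[OF group_action_axioms assms(1)])
  obtain \<rho>1 \<rho>2 :: "real \<Rightarrow> real"
    where controls: "\<forall>\<rho>\<in>{\<rho>1, \<rho>2}. \<rho> ` {0..} \<subseteq> {0..} \<and> mono_on {0..} \<rho> \<and> \<not> bdd_above (\<rho> ` {0..})"
    and emb_all: "\<forall>x\<in>OY. \<forall>x'\<in>OY.
      \<rho>1 (wd x x') \<le> dist (f x) (f x') \<and> dist (f x) (f x') \<le> \<rho>2 (wd x x')"
    using assms(9) unfolding coarse_embedding_def by (elim conjE exE) (rule that)
  have \<rho>: "mono_on {0..} \<rho>1" "mono_on {0..} \<rho>2" "\<not> bdd_above (\<rho>1 ` {0..})"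
    using controls by simp_all
  have emb: "\<rho>1 (wd x x') \<le> dist (f x) (f x') \<and> dist (f x) (f x') \<le> \<rho>2 (wd x x')"
    if "x \<in> OY" "x' \<in> OY" for x x'
    using emb_all that by blast
  define C where "C = \<rho>2 1"
  have close: "dist (f (r, x)) (f (r, y)) \<le> C" if "0 < r" "x \<in> Y" "y \<in> Y" "dist x y < 1 / r" for r x y
  proof -
    have cone: "(r, x) \<in> OY" "(r, y) \<in> OY" using that by (auto simp: infinite_cone_def)
    have "wd (r, x) (r, y) \<le> cone_dist Y (r, x) (r, y)"
      using warped cone by (simp add: warping_metrics_def)
    also have "\<dots> \<le> 1" using that by (simp add: cone_dist_def field_simps)
    finally have "\<rho>2 (wd (r, x) (r, y)) \<le> C"
      unfolding C_def using \<rho>(2) wd_nonneg by (auto simp: mono_on_def)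
    then show ?thesis using emb[OF cone] by linarith
  qed
  have "\<exists>F. continuous_on Y F \<and> (\<forall>y\<in>Y. dist (F y) (f (r, y)) \<le> C)" if "0 < r" for r
    by (rule continuous_approximation[OF assms(5), of "1 / r" "\<lambda>y. f (r, y)" C])
      (use that close in auto)
  then obtain F where F: "\<And>r. 0 < r \<Longrightarrow> continuous_on Y (F r)"
    "\<And>r y. 0 < r \<Longrightarrow> y \<in> Y \<Longrightarrow> dist (F r y) (f (r, y)) \<le> C"
    by metis
  have F_dist: "\<bar>dist (F r x) (F r y) - dist (f (r, x)) (f (r, y))\<bar> \<le> 2 * C"
    if "0 < r" "x \<in> Y" "y \<in> Y" for r x y
    using F(2)[OF that(1,2)] F(2)[OF that(1,3)] by metric
  have "\<exists>N. \<forall>d\<ge>real N. 2 ^ n + 2 * C \<le> \<rho>1 d" for n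
  proof -
    obtain d0 where d0: "0 \<le> d0" "2 ^ n + 2 * C \<le> \<rho>1 d0"
      using \<rho>(3) by (force simp: bdd_above_def not_le intro: less_imp_le)
    have "2 ^ n + 2 * C \<le> \<rho>1 d" if "real (nat \<lceil>d0\<rceil>) \<le> d" for d
    proof -
      have "d0 \<le> d" using that d0(1) by linarith
      then have "\<rho>1 d0 \<le> \<rho>1 d" using mono_onD[OF \<rho>(1), of d0 d] d0(1) by simp
      then show ?thesis using d0(2) by linarith
    qed
    then show ?thesis by blast
  qed
  then obtain N0 where N0: "\<And>n d. real (N0 n) \<le> d \<Longrightarrow> 2 ^ n + 2 * C \<le> \<rho>1 d" by metis
  (* Monotone in n, dominating N0 n, and at least n so that the balls of radius N n exhaust G. *)
  define N where "N n = n + (\<Sum>i\<le>n. N0 i)" for n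
  have N_ge: "n \<le> N n" "N0 n \<le> N n" for n
    by (auto simp: N_def intro: trans_le_add2 member_le_sum)
  have "\<exists>r>0. \<forall>g\<in>word_ball (N (Suc n)) - word_ball (N n). \<forall>y\<in>Y. real (N n) \<le> wd (r, y) (r, \<phi> g y)" for n
    using finite_word_ball word_ball_carrier by (intro displacement_large assms(8)) auto
  then obtain r where r: "\<And>n. 0 < r n" and sep: "\<And>n g y.
      g \<in> word_ball (N (Suc n)) - word_ball (N n) \<Longrightarrow> y \<in> Y \<Longrightarrow> real (N n) \<le> wd (r n, y) (r n, \<phi> g y)"
    by metis
  have cone: "(r n, y) \<in> OY" if "y \<in> Y" for n y using r that by (simp add: infinite_cone_def)
  show ?thesis
  proof (rule a_T_menable_action_series[OF assms(7,5), of "\<lambda>n. F (r n)"])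
    show "continuous_on Y (F (r n))" for n using F(1) r by blast
  next
    fix g assume g: "g \<in> carrier G"
    obtain k where k: "g \<in> word_ball k" using word_ball_exhausts[OF g] by blast
    have "dist (F (r n) y) (F (r n) (\<phi> g y)) \<le> \<rho>2 (real k) + 2 * C" if y: "y \<in> Y" for n y
    proof -
      have gy: "\<phi> g y \<in> Y" using element_image[OF g y] by blast
      have "wd (r n, y) (r n, \<phi> g y) \<le> real k"
        using wd_word_ball[OF k cone[OF y]] by (simp add: cone_action_def)
      then have "\<rho>2 (wd (r n, y) (r n, \<phi> g y)) \<le> \<rho>2 (real k)"
        using \<rho>(2) wd_nonneg by (auto simp: mono_on_def)
      then show ?thesis using emb[OF cone[OF y] cone[OF gy], of n n] F_dist[OF r y gy, of n] by linarith
    qed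
    then show "\<exists>B. \<forall>n. \<forall>y\<in>Y. dist (F (r n) y) (F (r n) (\<phi> g y)) \<le> B" by blast
  next
    fix m
    have "\<exists>n\<ge>m. \<forall>y\<in>Y. 2 ^ n \<le> dist (F (r n) y) (F (r n) (\<phi> g y))"
      if g: "g \<in> carrier G - word_ball (N m)" for g
    proof -
      obtain k where "g \<in> word_ball k" using word_ball_exhausts g by blast
      then have ex: "\<exists>k. g \<in> word_ball (N k)" using word_ball_mono[OF N_ge(1)] by blast
      (* The annulus containing g is the one ending at the first radius N l whose ball contains g. *)
      define l where "l = (LEAST k. g \<in> word_ball (N k))"
      have l: "g \<in> word_ball (N l)" "\<And>k. k < l \<Longrightarrow> g \<notin> word_ball (N k)"
        unfolding l_def using LeastI_ex[OF ex] not_less_Least by blast+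
      have "N a \<le> N b" if "a \<le> b" for a b
        unfolding N_def using that by (intro add_mono sum_mono2) auto
      then have "m < l" using l(1) g word_ball_mono by (meson DiffD2 not_le subsetD)
      then obtain n where n: "l = Suc n" "m \<le> n" by (cases l) auto
      have "2 ^ n \<le> dist (F (r n) y) (F (r n) (\<phi> g y))" if y: "y \<in> Y" for y
      proof -
        have gy: "\<phi> g y \<in> Y" using element_image[of g y] g y by blast
        have "real (N n) \<le> wd (r n, y) (r n, \<phi> g y)" using sep l n(1) y by blast
        then have "2 ^ n + 2 * C \<le> \<rho>1 (wd (r n, y) (r n, \<phi> g y))"
          using N_ge(2)[of n] by (intro N0) linarith
        then show ?thesis using emb[OF cone[OF y] cone[OF gy], of n n] F_dist[OF r y gy, of n] by linarith
      qed
      then show ?thesis using n(2) by blast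
    qed
    then show "\<exists>K. finite K \<and> K \<subseteq> carrier G \<and> (\<forall>g\<in>carrier G - K. \<exists>n\<ge>m. \<forall>y\<in>Y.
        2 ^ n \<le> dist (F (r n) y) (F (r n) (\<phi> g y)))"
      by (intro exI[of _ "word_ball (N m)"] conjI finite_word_ball word_ball_carrier ballI)
  qed
qed

end
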